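(* Let $A$ and $B$ be two closed convex sets in $\mathbb{R}^3$ with $A\cap B\neq\emptyset$, such that $A\cap B$ is bounded and has empty interior in $\mathbb{R}^3$. Then the family $\{A,B\}$ has the GPR property, that is: for every sequence $\{x_k\}_{k\in\mathbb{N}}$ in $\mathbb{R}^3$ such that $d(x_k,A)\to 0$ and $d(x_k,B)\to 0$ as $k\to\infty$, one has $d(x_k,A\cap B)\to 0$ as $k\to\infty$.
   Context: $\mathbb{R}^3$ carries the Euclidean norm $\|\cdot\|$, and for a nonempty set $S\subset\mathbb{R}^3$, $d(x,S)=\inf_{s\in S}\|x-s\|$. A family of closed convex sets $M_1,\dots,M_m$ with nonempty intersection in a real Hilbert space has the GPR (Gurin, Poliac and Raic) property if for any sequence $\{x_k\}$ (not assumed bounded) such that $d(x_k,M_i)\to 0$ for each $i$, one has $d\bigl(x_k,\bigcap_i M_i\bigr)\to 0$. *)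

theory Defs
  imports "HOL-Analysis.Analysis"
begin

(* A finite family is represented by the set of its members: repetitions affect
   neither the hypothesis on the sequence nor the intersection.  Closedness, convexity
   and nonempty intersection are standing assumptions on the family and are to be
   imposed where the property is used; under them infdist x S is the infimum of
   norm (x - s) over s in S (its convention for the empty set plays no role). *)
definition GPR_property :: "'a::{real_inner, complete_space} set set \<Rightarrow> bool" where
  "GPR_property \<M> \<longleftrightarrow>
     (\<forall>x :: nat \<Rightarrow> 'a.
        (\<forall>M\<in>\<M>. (\<lambda>k. infdist (x k) M) \<longlonglongrightarrow> 0)
        \<longrightarrow> (\<lambda>k. infdist (x k) (\<Inter>\<M>)) \<longlonglongrightarrow> 0)"

end

theory Submission imports Defs
begin

text \<open>
  In finite dimension boundedness of the intersection \<open>C \<noteq> {}\<close> forces the GPR property, for any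
  finite family of closed convex sets. The total distance \<open>g(x)\<close> of \<open>x\<close> to the members of the
  family is continuous, and it vanishes only on \<open>C\<close>. For \<open>e > 0\<close> the level set
  \<open>D = {y. infdist y C = e}\<close> is compact, because \<open>C\<close> is bounded, so \<open>g\<close> has a positive lower
  bound \<open>d\<close> on \<open>D\<close>.

  Convexity carries this bound to every point at distance at least \<open>e\<close> from \<open>C\<close>, however far
  away: the segment from a point of \<open>C\<close> to such an \<open>x\<close> meets \<open>D\<close>, and each distance to a convex
  member never decreases along the segment away from \<open>C\<close>, so \<open>g x \<ge> d\<close>. Hence an unbounded sequence
  causes no difficulty: as soon as \<open>g (x k) < d\<close>, one has \<open>infdist (x k) C < e\<close>.
\<close>

text \<open>
  Shrinking towards a point \<open>p\<close> of \<open>M\<close> maps \<open>M\<close> into itself and does not increase distances,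
  so each \<open>a \<in> M\<close> is sent to a point of \<open>M\<close> that is as close to \<open>y\<close> as \<open>a\<close> is to \<open>x\<close>, or closer.
\<close>

lemma infdist_mono_on_segment_from_member:
  fixes M :: "'a::real_normed_vector set"
  assumes "convex M" "p \<in> M" "y \<in> closed_segment p x"
  shows "infdist y M \<le> infdist x M"
proof -
  obtain u where u: "0 \<le> u" "u \<le> 1" and y: "y = (1 - u) *\<^sub>R p + u *\<^sub>R x"
    using assms(3) by (auto simp: in_segment)
  have "infdist y M \<le> dist x a" if "a \<in> M" for a
  proof -
    have "(1 - u) *\<^sub>R p + u *\<^sub>R a \<in> M"
      using assms that u by (simp add: convexD)
    then have "infdist y M \<le> dist y ((1 - u) *\<^sub>R p + u *\<^sub>R a)"
      by (rule infdist_le)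
    also have "\<dots> = norm (u *\<^sub>R (x - a))"
      by (simp add: y dist_norm scaleR_diff_right)
    also have "\<dots> = u * dist x a"
      using u by (simp add: dist_norm)
    also have "\<dots> \<le> dist x a"
      using u by (simp add: mult_left_le_one_le)
    finally show ?thesis .
  qed
  moreover have "M \<noteq> {}"
    using assms by blast
  ultimately show ?thesis
    by (metis infdist_notempty cINF_greatest)
qed

theorem GPR_property_if_bounded_Inter:
  fixes \<M> :: "'a::euclidean_space set set"
  assumes fin: "finite \<M>"
    and closed: "\<And>M. M \<in> \<M> \<Longrightarrow> closed M"
    and convex: "\<And>M. M \<in> \<M> \<Longrightarrow> convex M"
    and ne: "\<Inter>\<M> \<noteq> {}"
    and bdd: "bounded (\<Inter>\<M>)"
  shows "GPR_property \<M>"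
  unfolding GPR_property_def
proof (intro allI impI)
  fix x :: "nat \<Rightarrow> 'a"
  assume lim: "\<forall>M\<in>\<M>. (\<lambda>k. infdist (x k) M) \<longlonglongrightarrow> 0"
  define g where "g = (\<lambda>y. \<Sum>M\<in>\<M>. infdist y M)"
  obtain p where p: "p \<in> \<Inter>\<M>"
    using ne by blast
  have g_nonneg: "0 \<le> g y" for y
    by (simp add: g_def sum_nonneg infdist_nonneg)
  have g_zero: "y \<in> \<Inter>\<M>" if "g y = 0" for y
  proof
    fix M assume M: "M \<in> \<M>"
    then have "infdist y M = 0"
      using that fin by (simp add: g_def sum_nonneg_eq_0_iff infdist_nonneg)
    then show "y \<in> M"
      using M p closed in_closed_iff_infdist_zero by blast
  qed
  have g_lim: "(\<lambda>k. g (x k)) \<longlonglongrightarrow> 0"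
    unfolding g_def using lim by (intro tendsto_null_sum) auto
  show "(\<lambda>k. infdist (x k) (\<Inter>\<M>)) \<longlonglongrightarrow> 0"
  proof (rule LIMSEQ_I)
    fix e :: real assume e: "0 < e"
    define D where "D = {y. infdist y (\<Inter>\<M>) = e}"
    have "compact (\<Inter>\<M>)"
      using bdd closed by (simp add: compact_eq_bounded_closed closed_Inter)
    then have "compact {y. infdist y (\<Inter>\<M>) \<le> e}"
      using ne e by (intro compact_infdist_le)
    moreover have "closed D"
      unfolding D_def by (intro closed_Collect_eq continuous_intros)
    ultimately have "compact ({y. infdist y (\<Inter>\<M>) \<le> e} \<inter> D)"
      by (rule compact_Int_closed)
    moreover have "{y. infdist y (\<Inter>\<M>) \<le> e} \<inter> D = D"
      by (auto simp: D_def)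
    ultimately have "compact D"
      by simp
    have "continuous_on D g"
      unfolding g_def by (intro continuous_intros)
    have "\<exists>d>0. \<forall>y\<in>D. d \<le> g y"
    proof (cases "D = {}")
      case False
      then obtain z where z: "z \<in> D" "\<And>y. y \<in> D \<Longrightarrow> g z \<le> g y"
        using continuous_attains_inf \<open>compact D\<close> \<open>continuous_on D g\<close> by metis
      have "g z \<noteq> 0"
        using g_zero[of z] z(1) e by (auto simp: D_def)
      then show ?thesis
        using z(2) g_nonneg[of z] by (intro exI[of _ "g z"]) auto
    qed (auto intro: exI[of _ 1])
    then obtain d where d: "d > 0" "\<And>y. y \<in> D \<Longrightarrow> d \<le> g y"
      by blast
    have far: "d \<le> g y" if "e \<le> infdist y (\<Inter>\<M>)" for y
    proof -
      have "connected ((\<lambda>z. infdist z (\<Inter>\<M>)) ` closed_segment p y)"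
        by (intro connected_continuous_image continuous_intros connected_segment)
      moreover have "0 \<in> (\<lambda>z. infdist z (\<Inter>\<M>)) ` closed_segment p y"
        using p by (intro image_eqI[of _ _ p]) auto
      moreover have "infdist y (\<Inter>\<M>) \<in> (\<lambda>z. infdist z (\<Inter>\<M>)) ` closed_segment p y"
        by simp
      ultimately have "e \<in> (\<lambda>z. infdist z (\<Inter>\<M>)) ` closed_segment p y"
        using that e connectedD_interval by (metis less_imp_le)
      then obtain z where z: "z \<in> closed_segment p y" "z \<in> D"
        by (auto simp: D_def)
      have "g z \<le> g y"
        unfolding g_def using p z(1) convex
        by (intro sum_mono infdist_mono_on_segment_from_member) auto
      then show ?thesis
        using d(2)[OF z(2)] by simp
    qed
    from g_lim \<open>d > 0\<close> obtain N where N: "\<And>k. k \<ge> N \<Longrightarrow> g (x k) < d"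
      by (metis order_tendstoD(2) eventually_sequentially)
    have "infdist (x k) (\<Inter>\<M>) < e" if "k \<ge> N" for k
      using far[of "x k"] N[OF that] by linarith
    then show "\<exists>N. \<forall>k\<ge>N. norm (infdist (x k) (\<Inter>\<M>) - 0) < e"
      by (auto simp: infdist_nonneg)
  qed
qed

theorem lemma4:
  fixes A B :: "(real ^ 3) set"
  assumes "closed A" and "convex A"
    and "closed B" and "convex B"
    and "A \<inter> B \<noteq> {}"
    and "bounded (A \<inter> B)"
    and "interior (A \<inter> B) = {}"
  shows "GPR_property {A, B}"
  using assms by (intro GPR_property_if_bounded_Inter) auto

end
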